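(* Let $\mathcal{A}\in\mathbb{C}^{n\times n\times n_3}$. Then there exist a unitary tensor $\mathcal{Q}\in\mathbb{C}^{n\times n\times n_3}$ and an F-upper tensor $\mathcal{T}\in\mathbb{C}^{n\times n\times n_3}$ such that $$\mathcal{A}=\mathcal{Q}^H*_c\mathcal{T}*_c\mathcal{Q}.$$
   Context: For a third-order tensor $\mathcal{A}\in\mathbb{C}^{n_1\times n_2\times n_3}$, $\mathcal{A}^{(i)}=\mathcal{A}(:,:,i)\in\mathbb{C}^{n_1\times n_2}$ denotes its $i$-th frontal slice. Let $\mathbf{C}_{n_3}$ be the $n_3\times n_3$ orthogonal DCT matrix, with entries $(\mathbf{C}_{n_3})_{jk}=\sqrt{(2-\delta_{j1})/n_3}\,\cos\big(\tfrac{(j-1)(2k-1)\pi}{2n_3}\big)$; let $\mathbf{W}$ be the diagonal matrix whose diagonal is the first column of $\mathbf{C}_{n_3}$; let $\mathbf{Z}$ be the $n_3\times n_3$ matrix with ones on the first superdiagonal and zeros elsewhere; and put $\mathbf{M}=\mathbf{W}^{-1}\mathbf{C}_{n_3}(\mathbf{I}+\mathbf{Z})$, an invertible matrix. Define the linear bijection $L$ on tensors with third dimension $n_3$ by $L(\mathcal{A})_{ijk}=\sum_{l=1}^{n_3}\mathbf{M}_{kl}\mathcal{A}_{ijl}$. The C-product of $\mathcal{A}\in\mathbb{C}^{n_1\times n_2\times n_3}$ and $\mathcal{B}\in\mathbb{C}^{n_2\times l\times n_3}$ is the tensor $\mathcal{A}*_c\mathcal{B}\in\mathbb{C}^{n_1\times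 l\times n_3}$ determined by $L(\mathcal{A}*_c\mathcal{B})^{(i)}=L(\mathcal{A})^{(i)}L(\mathcal{B})^{(i)}$, $i=1,\dots,n_3$. The conjugate transpose $\mathcal{A}^H$ is determined by $L(\mathcal{A}^H)^{(i)}=(L(\mathcal{A})^{(i)})^H$ for all $i$. The identity tensor $\mathcal{I}\in\mathbb{C}^{n\times n\times n_3}$ is determined by $L(\mathcal{I})^{(i)}=\mathbf{I}_n$ for all $i$. A tensor $\mathcal{Q}\in\mathbb{C}^{n\times n\times n_3}$ is unitary if $\mathcal{Q}^H*_c\mathcal{Q}=\mathcal{Q}*_c\mathcal{Q}^H=\mathcal{I}$. A tensor is F-upper if all its frontal slices are upper triangular matrices. *)

theory Defs
  imports Complex_Main "Jordan_Normal_Form.Schur_Decomposition"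
begin

text \<open>
  A third-order tensor of size \<open>n1 \<times> n2 \<times> n3\<close> is the list of its \<open>n3\<close> frontal slices,
  so \<open>A ! k $$ (i, j)\<close> is the entry \<open>A(i+1, j+1, k+1)\<close>.  All indices are 0-based.
  The size of a tensor is read off from the length of the list and from its first slice, which is
  the intended size only if \<open>n3 > 0\<close> and all slices have the same dimensions.
\<close>

type_synonym ctensor = "complex mat list"

definition carrier_tensor :: "nat \<Rightarrow> nat \<Rightarrow> nat \<Rightarrow> ctensor set" where
  "carrier_tensor n1 n2 n3 = {A. length A = n3 \<and> (\<forall>k<n3. A ! k \<in> carrier_mat n1 n2)}"

definition tdim_row :: "ctensor \<Rightarrow> nat" where
  "tdim_row A = dim_row (A ! 0)"

definition tdim_col :: "ctensor \<Rightarrow> nat" where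
  "tdim_col A = dim_col (A ! 0)"

text \<open>With 0-based \<open>j\<close> and \<open>k\<close>, the angle \<open>(j - 1)(2k - 1)\<pi> / (2n)\<close> becomes
  \<open>j(2k + 1)\<pi> / (2n)\<close>.\<close>

definition dct_mat :: "nat \<Rightarrow> real mat" where
  "dct_mat n = mat n n (\<lambda>(j, k).
     sqrt ((2 - (if j = 0 then 1 else 0)) / real n)
       * cos (real j * (2 * real k + 1) * pi / (2 * real n)))"

definition dct_W :: "nat \<Rightarrow> real mat" where
  "dct_W n = mat_diag n (\<lambda>i. dct_mat n $$ (i, 0))"

definition shift_Z :: "nat \<Rightarrow> real mat" where
  "shift_Z n = mat n n (\<lambda>(i, j). if j = Suc i then 1 else 0)"

definition dct_M :: "nat \<Rightarrow> real mat" where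
  "dct_M n = the (mat_inverse (dct_W n)) * dct_mat n * (1\<^sub>m n + shift_Z n)"

definition L_trans :: "ctensor \<Rightarrow> ctensor" where
  "L_trans A = map (\<lambda>k. mat (tdim_row A) (tdim_col A) (\<lambda>(i, j).
     \<Sum>l<length A. complex_of_real (dct_M (length A) $$ (k, l)) * (A ! l $$ (i, j))))
     [0..<length A]"

text \<open>The operations below are determined by their images under \<open>L_trans\<close>, which for
  \<open>n3 > 0\<close> is a bijection of \<open>carrier_tensor n1 n2 n3\<close> onto itself because \<open>dct_M n3\<close> is
  invertible.  The product is meant for \<open>tdim_col A = tdim_row B\<close> and
  \<open>length A = length B\<close>.\<close>

definition c_prod :: "ctensor \<Rightarrow> ctensor \<Rightarrow> ctensor" (infixl "*\<^sub>c" 70) where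
  "A *\<^sub>c B = (THE C. C \<in> carrier_tensor (tdim_row A) (tdim_col B) (length A) \<and>
     (\<forall>i<length A. L_trans C ! i = L_trans A ! i * L_trans B ! i))"

definition tensor_adjoint :: "ctensor \<Rightarrow> ctensor" where
  "tensor_adjoint A = (THE B. B \<in> carrier_tensor (tdim_col A) (tdim_row A) (length A) \<and>
     (\<forall>i<length A. L_trans B ! i = mat_adjoint (L_trans A ! i)))"

definition id_tensor :: "nat \<Rightarrow> nat \<Rightarrow> ctensor" where
  "id_tensor n n3 = (THE I. I \<in> carrier_tensor n n n3 \<and> (\<forall>i<n3. L_trans I ! i = 1\<^sub>m n))"

definition unitary_tensor :: "nat \<Rightarrow> nat \<Rightarrow> ctensor \<Rightarrow> bool" where
  "unitary_tensor n n3 Q \<longleftrightarrow> Q \<in> carrier_tensor n n n3 \<and>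
     tensor_adjoint Q *\<^sub>c Q = id_tensor n n3 \<and> Q *\<^sub>c tensor_adjoint Q = id_tensor n n3"

definition F_upper :: "ctensor \<Rightarrow> bool" where
  "F_upper T \<longleftrightarrow> (\<forall>i<length T. upper_triangular (T ! i))"

end

theory Submission
  imports Defs
begin

text \<open>
  The transform \<open>L_trans\<close> turns every tensor operation into the corresponding matrix operation on
  each frontal slice separately.  In the transformed domain the claim is therefore Schur's theorem
  for \<open>n3\<close> independent complex matrices: every slice of the transform of \<open>A\<close> is
  \<open>U * S * mat_adjoint U\<close> with \<open>U\<close> unitary and \<open>S\<close> upper triangular
  (\<open>unitary_schur_decomposition\<close>).  Since the theorem has the adjoint of \<open>Q\<close> on the left, the
  slices \<open>mat_adjoint U\<close> are the ones pulled back to \<open>Q\<close>, and the slices \<open>S\<close> are pulled back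
  to \<open>T\<close>.

  Being F-upper is a condition on the slices of \<open>T\<close> and not on those of its transform.  It survives
  the inverse transform because each slice of \<open>T\<close> is a linear combination of the slices \<open>S\<close>, and
  upper triangular matrices form a linear subspace (\<open>F_upper_mode3\<close>).

  All of this needs the transform to be invertible, which makes the definite descriptions behind
  the tensor operations meaningful (\<open>the_tensor_with_transform\<close>).  The matrix \<open>dct_M\<close> is a product
  of three factors with nonzero determinant: the inverse of a diagonal matrix with positive entries,
  the discrete cosine transform, which is orthogonal (\<open>dct_mat_orthogonal\<close>), and a unitriangular
  matrix.
\<close>

section \<open>Adjoints of complex matrices\<close>

lemma index_mat_adjoint [simp]:
  fixes A :: "complex mat"
  assumes "i < dim_col A" "j < dim_row A"
  shows "mat_adjoint A $$ (i, j) = cnj (A $$ (j, i))"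
  using assms by (simp add: mat_adjoint_def mat_of_rows_index conjugate_complex_def)

lemma dim_mat_adjoint [simp]:
  "dim_row (mat_adjoint A) = dim_col A" "dim_col (mat_adjoint A) = dim_row A"
  by (simp_all add: mat_adjoint_def)

lemma mat_adjoint_carrier [simp, intro]:
  "A \<in> carrier_mat n m \<Longrightarrow> mat_adjoint A \<in> carrier_mat m n"
  by (intro carrier_matI) (simp_all add: carrier_matD)

lemma mat_adjoint_adjoint [simp]:
  fixes A :: "complex mat"
  shows "mat_adjoint (mat_adjoint A) = A"
  by (rule eq_matI) auto

lemma mat_adjoint_mult:
  fixes A B :: "complex mat"
  assumes "A \<in> carrier_mat n m" "B \<in> carrier_mat m p"
  shows "mat_adjoint (A * B) = mat_adjoint B * mat_adjoint A"
proof (rule eq_matI)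
  fix i j assume "i < dim_row (mat_adjoint B * mat_adjoint A)" "j < dim_col (mat_adjoint B * mat_adjoint A)"
  then have "i < p" "j < n" using assms by auto
  then have "mat_adjoint (A * B) $$ (i, j) = (\<Sum>k = 0..<m. cnj (A $$ (j, k) * B $$ (k, i)))"
    using assms by (simp add: scalar_prod_def)
  also have "\<dots> = (mat_adjoint B * mat_adjoint A) $$ (i, j)"
    using assms \<open>i < p\<close> \<open>j < n\<close> by (simp add: scalar_prod_def mult.commute)
  finally show "mat_adjoint (A * B) $$ (i, j) = (mat_adjoint B * mat_adjoint A) $$ (i, j)" .
qed (use assms in auto)

lemma mat_adjoint_four_block_diag:
  fixes B D :: "complex mat"
  assumes "B \<in> carrier_mat n n" "D \<in> carrier_mat m m"
  shows "mat_adjoint (four_block_mat B (0\<^sub>m n m) (0\<^sub>m m n) D) =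
    four_block_mat (mat_adjoint B) (0\<^sub>m n m) (0\<^sub>m m n) (mat_adjoint D)"
  (is "mat_adjoint ?L = ?R")
proof (rule eq_matI)
  fix i j assume "i < dim_row ?R" "j < dim_col ?R"
  then have ij: "i < n + m" "j < n + m" using assms by simp_all
  then show "mat_adjoint ?L $$ (i, j) = ?R $$ (i, j)"
    using assms by (cases "i < n"; cases "j < n") simp_all
qed (use assms in simp_all)

lemma mat_adjoint_one: "mat_adjoint (1\<^sub>m n :: complex mat) = 1\<^sub>m n"
  by (rule eq_matI) auto

lemma unitary_mult:
  fixes U V :: "complex mat"
  assumes U: "U \<in> carrier_mat n n" "mat_adjoint U * U = 1\<^sub>m n"
    and V: "V \<in> carrier_mat n n" "mat_adjoint V * V = 1\<^sub>m n"
  shows "mat_adjoint (U * V) * (U * V) = 1\<^sub>m n"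
proof -
  have "mat_adjoint U * (U * V) = mat_adjoint U * U * V"
    by (rule assoc_mult_mat[OF mat_adjoint_carrier[OF U(1)] U(1) V(1), symmetric])
  then have "mat_adjoint U * (U * V) = V"
    unfolding U(2) left_mult_one_mat[OF V(1)] .
  moreover have "mat_adjoint (U * V) * (U * V) = mat_adjoint V * (mat_adjoint U * (U * V))"
    unfolding mat_adjoint_mult[OF U(1) V(1)]
    by (rule assoc_mult_mat[OF mat_adjoint_carrier[OF V(1)] mat_adjoint_carrier[OF U(1)]
          mult_carrier_mat[OF U(1) V(1)]])
  ultimately show ?thesis by (simp only: V(2))
qed

section \<open>Unitary triangularization of a matrix\<close>

lemma mat_adjoint_mult_index:
  fixes U :: "complex mat"
  assumes "i < dim_col U" "j < dim_col U"
  shows "(mat_adjoint U * U) $$ (i, j) = col U j \<bullet>c col U i"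
  using assms by (auto simp: scalar_prod_def conjugate_complex_def mult.commute)

text \<open>Completing \<open>v\<close> to a basis and applying Gram-Schmidt keeps \<open>v\<close> as the first vector and gives
  pairwise orthogonal nonzero vectors; scaling each to norm one makes the matrix of columns
  unitary.\<close>

lemma unitary_matrix_with_given_direction:
  fixes v :: "complex vec"
  assumes v: "v \<in> carrier_vec n" "v \<noteq> 0\<^sub>v n"
  obtains U c where "U \<in> carrier_mat n n" "mat_adjoint U * U = 1\<^sub>m n" "col U 0 = c \<cdot>\<^sub>v v"
proof -
  interpret cof_vec_space n "TYPE(complex)" .
  define b where "b = basis_completion v"
  define ws where "ws = gram_schmidt n b"
  note bc = basis_completion[OF v, folded b_def]
  have n0: "0 < n" using v by (cases n) auto
  have ws: "set ws \<subseteq> carrier_vec n" "corthogonal ws" "length ws = n"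
    using gram_schmidt_result[OF bc(2,4,5), of ws] bc(6) by (auto simp: ws_def)
  have "ws ! 0 = v"
  proof -
    have "b = v # tl b" using bc(6,7) n0 by (cases b) auto
    then have "hd ws = v" using gram_schmidt_hd[OF v(1), of "tl b"] by (simp add: ws_def)
    then show ?thesis using ws(3) n0 by (cases ws) auto
  qed
  define c where "c i = complex_of_real (1 / sqrt (Re (ws ! i \<bullet>c ws ! i)))" for i
  define U where "U = mat_of_cols n (map (\<lambda>i. c i \<cdot>\<^sub>v ws ! i) [0..<n])"
  have U: "U \<in> carrier_mat n n" unfolding U_def by (intro carrier_matI) simp_all
  have wsc: "ws ! i \<in> carrier_vec n" if "i < n" for i using ws that by auto
  have colU: "col U i = c i \<cdot>\<^sub>v ws ! i" if "i < n" for i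
    unfolding U_def using that wsc[OF that] by (subst col_mat_of_cols) auto
  have sp: "(c j \<cdot>\<^sub>v ws ! j) \<bullet>c (c i \<cdot>\<^sub>v ws ! i) = c j * cnj (c i) * (ws ! j \<bullet>c ws ! i)"
    if "i < n" "j < n" for i j
    using wsc[OF that(1)] wsc[OF that(2)]
    by (auto simp: scalar_prod_def sum_distrib_left conjugate_complex_def intro!: sum.cong)
  have norm: "c i * cnj (c i) * (ws ! i \<bullet>c ws ! i) = 1" if i: "i < n" for i
  proof -
    let ?s = "ws ! i \<bullet>c ws ! i"
    have "?s \<noteq> 0" using corthogonalD[OF ws(2), of i i] i ws(3) by simp
    moreover have "?s \<ge> 0" using conjugate_square_ge_0_vec[of "ws ! i"] by simp
    ultimately have s: "?s = complex_of_real (Re ?s)" "Re ?s > 0"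
      by (auto simp: less_eq_complex_def complex_eq_iff)
    have "c i * cnj (c i) = complex_of_real (1 / Re ?s)"
      using s(2) by (simp add: c_def flip: of_real_mult)
    then have "c i * cnj (c i) * ?s = complex_of_real (1 / Re ?s) * complex_of_real (Re ?s)"
      by (simp only: s(1)[symmetric])
    also have "\<dots> = 1" using s(2) by (simp flip: of_real_mult)
    finally show ?thesis .
  qed
  have "mat_adjoint U * U = 1\<^sub>m n"
  proof (rule eq_matI)
    fix i j assume ij: "i < dim_row (1\<^sub>m n :: complex mat)" "j < dim_col (1\<^sub>m n :: complex mat)"
    then have "(mat_adjoint U * U) $$ (i, j) = c j * cnj (c i) * (ws ! j \<bullet>c ws ! i)"
      using U by (subst mat_adjoint_mult_index) (auto simp: colU sp)
    also have "\<dots> = 1\<^sub>m n $$ (i, j)"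
      using ij norm corthogonalD[OF ws(2), of j i] ws(3) by auto
    finally show "(mat_adjoint U * U) $$ (i, j) = 1\<^sub>m n $$ (i, j)" .
  qed (use U in auto)
  then show thesis using that U colU[OF n0] \<open>ws ! 0 = v\<close> by auto
qed

text \<open>One step of Schur's argument: in an orthonormal basis that starts with an eigenvector, the
  first column of the matrix has zeros below its first entry.\<close>

lemma unitary_deflation:
  fixes A :: "complex mat"
  assumes A: "A \<in> carrier_mat (Suc m) (Suc m)"
  obtains U A1 A2 A3 where "U \<in> carrier_mat (Suc m) (Suc m)" "mat_adjoint U * U = 1\<^sub>m (Suc m)"
    "A1 \<in> carrier_mat 1 1" "A2 \<in> carrier_mat 1 m" "A3 \<in> carrier_mat m m"
    "A = U * four_block_mat A1 A2 (0\<^sub>m m 1) A3 * mat_adjoint U"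
proof -
  let ?n = "Suc m"
  obtain es where es: "char_poly A = (\<Prod>e\<leftarrow>es. [:- e, 1:])" "length es = ?n"
    using char_poly_factorized[OF A] by auto
  then obtain e es' where "es = e # es'" by (cases es) auto
  then have "eigenvalue A e" using es unfolding eigenvalue_root_char_poly[OF A] by simp
  then obtain v where v: "v \<in> carrier_vec ?n" "v \<noteq> 0\<^sub>v ?n" "A *\<^sub>v v = e \<cdot>\<^sub>v v"
    using A unfolding eigenvalue_def eigenvector_def by auto
  obtain U c where U: "U \<in> carrier_mat ?n ?n" and UU: "mat_adjoint U * U = 1\<^sub>m ?n"
    and col: "col U 0 = c \<cdot>\<^sub>v v"
    using unitary_matrix_with_given_direction[OF v(1,2)] .
  have UU': "U * mat_adjoint U = 1\<^sub>m ?n"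
    using mat_mult_left_right_inverse[OF _ U UU] U by auto
  define A' where "A' = mat_adjoint U * (A * U)"
  have A': "A' \<in> carrier_mat ?n ?n" using A U by (auto simp: A'_def)
  have "col (A * U) 0 = A *\<^sub>v (c \<cdot>\<^sub>v v)" using col_mult2[OF A U, of 0] col by simp
  also have "\<dots> = e \<cdot>\<^sub>v col U 0"
    using mult_mat_vec[OF A v(1)] v by (simp add: col smult_smult_assoc mult.commute)
  finally have colAU: "col (A * U) 0 = e \<cdot>\<^sub>v col U 0" .
  have AU: "A * U \<in> carrier_mat ?n ?n" using A U by auto
  have "col A' 0 = mat_adjoint U *\<^sub>v (e \<cdot>\<^sub>v col U 0)"
    unfolding A'_def using col_mult2[of "mat_adjoint U" ?n ?n "A * U" ?n 0] U AU colAU by auto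
  also have "\<dots> = e \<cdot>\<^sub>v (mat_adjoint U *\<^sub>v col U 0)"
    by (rule mult_mat_vec[OF mat_adjoint_carrier[OF U]]) (simp add: col v(1))
  also have "mat_adjoint U *\<^sub>v col U 0 = col (1\<^sub>m ?n) 0"
    using col_mult2[of "mat_adjoint U" ?n ?n U ?n 0] U UU by auto
  finally have colA': "col A' 0 = e \<cdot>\<^sub>v unit_vec ?n 0" by simp
  obtain A1 A2 A0 A3 where split: "split_block A' 1 1 = (A1, A2, A0, A3)"
    by (cases "split_block A' 1 1") auto
  have "dim_row A' = 1 + m" "dim_col A' = 1 + m" using A' by auto
  note sb = split_block[OF split this]
  have "A0 = 0\<^sub>m m 1"
  proof (rule eq_matI)
    fix i j assume "i < dim_row (0\<^sub>m m 1 :: complex mat)" "j < dim_col (0\<^sub>m m 1 :: complex mat)"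
    then have ij: "i < m" "j = 0" by auto
    have "A0 $$ (i, 0) = A' $$ (Suc i, 0)"
      unfolding sb(5) using ij sb by auto
    also have "\<dots> = col A' 0 $ Suc i" using ij A' by auto
    finally show "A0 $$ (i, j) = 0\<^sub>m m 1 $$ (i, j)" using ij by (simp add: colA')
  qed (use sb in auto)
  moreover have "A = U * A' * mat_adjoint U"
  proof -
    have "U * A' * mat_adjoint U = U * mat_adjoint U * A * (U * mat_adjoint U)"
      unfolding A'_def using A U
      by (simp add: assoc_mult_mat[of _ ?n ?n _ ?n _ ?n] mult_carrier_mat[of _ ?n ?n]
          del: assoc_mult_mat mult_carrier_mat)
    then show ?thesis using A by (simp add: UU')
  qed
  ultimately show thesis using that[OF U UU sb(1,2,4)] sb(5) by auto
qed

text \<open>Deflation leaves a smaller block \<open>A3\<close>.  If \<open>V\<close> triangularizes it, the block diagonal matrix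
  \<open>D\<close> of \<open>1\<close> and \<open>V\<close> triangularizes the deflated matrix.  Multiplying by \<open>D\<close> keeps the zeros of
  the first column, and \<open>W * D\<close> is the unitary matrix sought.\<close>

theorem unitary_schur_decomposition:
  fixes A :: "complex mat"
  assumes "A \<in> carrier_mat n n"
  shows "\<exists>U T. U \<in> carrier_mat n n \<and> T \<in> carrier_mat n n \<and> mat_adjoint U * U = 1\<^sub>m n \<and>
    upper_triangular T \<and> A = U * T * mat_adjoint U"
  using assms
proof (induction n arbitrary: A)
  case 0
  then show ?case by (intro exI[of _ "1\<^sub>m 0"]) (auto intro!: eq_matI)
next
  case (Suc m)
  obtain W A1 A2 A3 where W: "W \<in> carrier_mat (Suc m) (Suc m)" "mat_adjoint W * W = 1\<^sub>m (Suc m)"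
    and A1: "A1 \<in> carrier_mat 1 1" and A2: "A2 \<in> carrier_mat 1 m" and A3: "A3 \<in> carrier_mat m m"
    and A: "A = W * four_block_mat A1 A2 (0\<^sub>m m 1) A3 * mat_adjoint W"
    using unitary_deflation[OF Suc.prems] .
  obtain V B where V: "V \<in> carrier_mat m m" "mat_adjoint V * V = 1\<^sub>m m"
    and B: "B \<in> carrier_mat m m" "upper_triangular B" and A3_eq: "A3 = V * B * mat_adjoint V"
    using Suc.IH[OF A3] by blast
  have VV': "V * mat_adjoint V = 1\<^sub>m m"
    using mat_mult_left_right_inverse[OF _ V(1) V(2)] V by auto
  define D where "D = four_block_mat (1\<^sub>m 1) (0\<^sub>m 1 m) (0\<^sub>m m 1) V"
  define T where "T = four_block_mat A1 (A2 * V) (0\<^sub>m m 1) B"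
  have adjD: "mat_adjoint D = four_block_mat (1\<^sub>m 1) (0\<^sub>m 1 m) (0\<^sub>m m 1) (mat_adjoint V)"
    unfolding D_def using V(1) by (subst mat_adjoint_four_block_diag) (auto simp: mat_adjoint_one)
  have D: "D \<in> carrier_mat (Suc m) (Suc m)"
    unfolding D_def using four_block_carrier_mat[OF one_carrier_mat[of 1] V(1)] by simp
  have T: "T \<in> carrier_mat (Suc m) (Suc m)"
    unfolding T_def using four_block_carrier_mat[OF A1 B(1)] by simp
  have DD: "mat_adjoint D * D = 1\<^sub>m (Suc m)"
  proof -
    have "mat_adjoint D * D = four_block_mat (1\<^sub>m 1) (0\<^sub>m 1 m) (0\<^sub>m m 1) (1\<^sub>m m)"
      unfolding adjD unfolding D_def using V
      by (subst mult_four_block_mat[of _ 1 1 _ m _ m _ _ 1 _ m]) auto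
    then show ?thesis by simp
  qed
  have "D * T = four_block_mat A1 (A2 * V) (0\<^sub>m m 1) (V * B)"
    unfolding D_def T_def using V A1 A2 B
    by (subst mult_four_block_mat[of _ 1 1 _ m _ m _ _ 1 _ m]) auto
  then have "D * T * mat_adjoint D =
      four_block_mat A1 (A2 * V) (0\<^sub>m m 1) (V * B) * mat_adjoint D"
    by simp
  also have "\<dots> =
      four_block_mat A1 (A2 * V * mat_adjoint V) (0\<^sub>m m 1) (V * B * mat_adjoint V)"
    unfolding adjD using V A1 A2 B
    by (subst mult_four_block_mat[of _ 1 1 _ m _ m _ _ 1 _ m]) auto
  also have "A2 * V * mat_adjoint V = A2"
    using assoc_mult_mat[OF A2 V(1) mat_adjoint_carrier[OF V(1)]] VV' A2 by simp
  finally have "A = W * (D * T * mat_adjoint D) * mat_adjoint W"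
    by (simp only: A A3_eq)
  also have "\<dots> = (W * D) * T * mat_adjoint (W * D)"
    unfolding mat_adjoint_mult[OF W(1) D] using W(1) D T
    by (simp add: assoc_mult_mat[of _ "Suc m" "Suc m" _ "Suc m" _ "Suc m"]
        mult_carrier_mat[of _ "Suc m" "Suc m"]
        del: assoc_mult_mat mult_carrier_mat)
  finally have "A = (W * D) * T * mat_adjoint (W * D)" .
  moreover have "mat_adjoint (W * D) * (W * D) = 1\<^sub>m (Suc m)"
    by (rule unitary_mult[OF W D DD])
  moreover have "upper_triangular A1" using A1 by (intro upper_triangularI) auto
  then have "upper_triangular T"
    unfolding T_def using upper_triangular_four_block[OF A1 B(1) _ B(2)] by auto
  ultimately show ?case using mult_carrier_mat[OF W(1) D] T
    by (intro exI[of _ "W * D"] exI[of _ T] conjI)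
qed

section \<open>Invertibility of the cosine transform\<close>

text \<open>After multiplication by \<open>2 * sin x\<close> the sum telescopes, since
  \<open>2 * sin x * cos ((2 * k + 1) * x) = sin (2 * (k + 1) * x) - sin (2 * k * x)\<close>.\<close>

lemma sum_cos_odd_multiples:
  fixes x :: real
  shows "2 * sin x * (\<Sum>k<n. cos ((2 * real k + 1) * x)) = sin (2 * real n * x)"
proof (induction n)
  case (Suc n)
  have "sin (2 * real (Suc n) * x) = sin ((2 * real n + 1) * x + x)"
    by (simp add: algebra_simps)
  moreover have "sin (2 * real n * x) = sin ((2 * real n + 1) * x - x)"
    by (simp add: algebra_simps)
  ultimately show ?case using Suc.IH
    by (simp add: sin_add sin_diff distrib_left)
qed simp

text \<open>At the angle \<open>m * \<pi> / (2 * n)\<close> the telescoped sum is \<open>sin (m * \<pi>) = 0\<close>, while the bound on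
  \<open>m\<close> keeps the sine of the angle itself away from zero unless \<open>m = 0\<close>.\<close>

lemma sum_cos_grid:
  assumes "\<bar>m\<bar> < 2 * int n"
  shows "(\<Sum>k<n. cos ((2 * real k + 1) * (of_int m * pi / (2 * real n)))) =
    (if m = 0 then real n else 0)"
proof (cases "m = 0")
  case False
  let ?x = "of_int m * pi / (2 * real n)"
  have n: "real n > 0" using assms by auto
  have m: "\<bar>real_of_int m\<bar> < 2 * real n" using assms by linarith
  have "\<bar>?x\<bar> = \<bar>real_of_int m\<bar> * pi / (2 * real n)" by (simp add: abs_mult)
  also have "\<dots> < pi" using n m by (simp add: divide_less_eq mult.commute)
  finally have "- pi < ?x" "?x < pi" by linarith+
  then have "sin ?x \<noteq> 0" using sin_eq_0_pi[of ?x] False n by auto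
  moreover have "sin (2 * real n * ?x) = 0"
    using n sin_npi_int[of m] by (simp add: mult.commute)
  ultimately show ?thesis using sum_cos_odd_multiples[of ?x n] False by simp
qed simp

text \<open>The product-to-sum formula turns the inner product of rows \<open>i\<close> and \<open>j\<close> into the grid sums for
  \<open>i - j\<close> and \<open>i + j\<close>.  The second is nonzero only for \<open>i = j = 0\<close>, where it doubles the result;
  this is what the smaller weight of row \<open>0\<close> compensates.\<close>

lemma dct_mat_orthogonal: "dct_mat n * transpose_mat (dct_mat n) = 1\<^sub>m n"
proof (rule eq_matI)
  fix i j assume "i < dim_row (1\<^sub>m n :: real mat)" "j < dim_col (1\<^sub>m n :: real mat)"
  then have ij: "i < n" "j < n" by auto
  define s where "s i = sqrt ((2 - (if i = 0 then 1 else 0)) / real n)" for i :: nat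
  define C where "C m = (\<Sum>k<n. cos ((2 * real k + 1) * (of_int m * pi / (2 * real n))))" for m
  have "(dct_mat n * transpose_mat (dct_mat n)) $$ (i, j) =
      (\<Sum>k<n. s i * s j * (cos (real i * (2 * real k + 1) * pi / (2 * real n)) *
        cos (real j * (2 * real k + 1) * pi / (2 * real n))))"
    using ij by (simp add: dct_mat_def scalar_prod_def s_def atLeast0LessThan mult_ac)
  also have "\<dots> = s i * s j * (\<Sum>k<n.
        (cos ((2 * real k + 1) * (of_int (int i - int j) * pi / (2 * real n))) +
        cos ((2 * real k + 1) * (of_int (int i + int j) * pi / (2 * real n)))) / 2)"
    unfolding sum_distrib_left cos_times_cos
    by (intro sum.cong refl arg_cong2[of _ _ _ _ "(*)"] arg_cong2[of _ _ _ _ "(/)"]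
          arg_cong2[of _ _ _ _ "(+)"] arg_cong[of _ _ cos])
      (auto simp: field_simps)
  also have "\<dots> = s i * s j * ((C (int i - int j) + C (int i + int j)) / 2)"
    by (simp add: C_def sum.distrib flip: sum_divide_distrib)
  also have "C (int i - int j) = (if i = j then real n else 0)"
    unfolding C_def using ij by (subst sum_cos_grid) auto
  also have "C (int i + int j) = (if i = 0 \<and> j = 0 then real n else 0)"
    unfolding C_def using ij by (subst sum_cos_grid) auto
  also have "s i * s j * (((if i = j then real n else 0) + (if i = 0 \<and> j = 0 then real n else 0)) / 2)
      = 1\<^sub>m n $$ (i, j)"
    using ij by (auto simp: s_def field_simps)
  finally show "(dct_mat n * transpose_mat (dct_mat n)) $$ (i, j) = 1\<^sub>m n $$ (i, j)" .
qed (auto simp: dct_mat_def)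

lemma det_nonzero_of_right_inverse:
  fixes A B :: "'a :: idom mat"
  assumes "A \<in> carrier_mat n n" "B \<in> carrier_mat n n" "A * B = 1\<^sub>m n"
  shows "det A \<noteq> 0"
  using det_mult[OF assms(1,2)] assms(3) by auto

text \<open>The angles in the first column lie in \<open>[0, \<pi> / 2)\<close>, where the cosine is positive.\<close>

lemma dct_mat_first_column_pos:
  assumes "i < n"
  shows "dct_mat n $$ (i, 0) > 0"
proof -
  let ?x = "real i * pi / (2 * real n)"
  have "?x < pi / 2" "0 \<le> ?x" using assms by (simp_all add: field_simps)
  then have "cos ?x > 0" using pi_gt_zero by (intro cos_gt_zero_pi) linarith+
  moreover have "dct_mat n $$ (i, 0) = sqrt ((2 - (if i = 0 then 1 else 0)) / real n) * cos ?x"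
    using assms by (simp add: dct_mat_def)
  ultimately show ?thesis using assms by simp
qed

lemma det_dct_W_nonzero: "det (dct_W n) \<noteq> 0"
proof -
  have "det (dct_W n) = prod_list (diag_mat (dct_W n))"
    by (intro det_upper_triangular[of _ n] upper_triangularI) (simp_all add: dct_W_def mat_diag_def)
  also have "\<dots> = (\<Prod>i = 0..<n. dct_mat n $$ (i, 0))"
    by (simp add: prod_list_diag_prod dct_W_def mat_diag_def)
  also have "\<dots> > 0" by (intro prod_pos) (simp add: dct_mat_first_column_pos)
  finally show ?thesis by simp
qed

lemma mat_inverse_of_det_nonzero:
  fixes A :: "'a :: field mat"
  assumes A: "A \<in> carrier_mat n n" and "det A \<noteq> 0"
  shows "the (mat_inverse A) \<in> carrier_mat n n" "A * the (mat_inverse A) = 1\<^sub>m n"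
    "the (mat_inverse A) * A = 1\<^sub>m n"
proof -
  have "A \<in> Units (ring_mat TYPE('a) n ())" by (rule det_non_zero_imp_unit[OF assms])
  then obtain B where "mat_inverse A = Some B" using mat_inverse(1)[OF A] by fastforce
  then show "the (mat_inverse A) \<in> carrier_mat n n" "A * the (mat_inverse A) = 1\<^sub>m n"
    "the (mat_inverse A) * A = 1\<^sub>m n"
    using mat_inverse(2)[OF A] by auto
qed

lemma dct_M_carrier [simp]: "dct_M n \<in> carrier_mat n n"
  using mat_inverse_of_det_nonzero(1)[OF _ det_dct_W_nonzero[of n]]
  by (auto simp: dct_M_def dct_W_def dct_mat_def shift_Z_def intro!: mult_carrier_mat[of _ n n])

lemma det_dct_M_nonzero: "det (dct_M n) \<noteq> 0"
proof -
  have W: "dct_W n \<in> carrier_mat n n" by (simp add: dct_W_def)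
  note Wi = mat_inverse_of_det_nonzero[OF W det_dct_W_nonzero]
  have C: "dct_mat n \<in> carrier_mat n n" by (simp add: dct_mat_def)
  have Z: "1\<^sub>m n + shift_Z n \<in> carrier_mat n n" by (simp add: shift_Z_def)
  have "det (1\<^sub>m n + shift_Z n) = prod_list (diag_mat (1\<^sub>m n + shift_Z n))"
    using Z by (intro det_upper_triangular[of _ n] upper_triangularI) (auto simp: shift_Z_def)
  also have "\<dots> = 1"
    by (simp add: prod_list_diag_prod shift_Z_def)
  finally have "det (1\<^sub>m n + shift_Z n) = 1" .
  moreover have "det (the (mat_inverse (dct_W n))) \<noteq> 0"
    using det_nonzero_of_right_inverse[OF Wi(1) W Wi(3)] .
  moreover have "det (dct_mat n) \<noteq> 0"
    using C by (intro det_nonzero_of_right_inverse[OF C _ dct_mat_orthogonal])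
      (simp only: transpose_carrier_mat)
  ultimately show ?thesis
    unfolding dct_M_def det_mult[OF mult_carrier_mat[OF Wi(1) C] Z] det_mult[OF Wi(1) C]
    by simp
qed

section \<open>Mode-3 transforms of tensors\<close>

text \<open>The tensor-matrix product along the third mode, for an arbitrary coefficient matrix.  Both
  \<open>L_trans\<close> and its inverse are instances, so that inverting \<open>L_trans\<close> reduces to inverting a matrix.
  The slice dimensions \<open>r\<close> and \<open>c\<close> are parameters because a list of slices that may be empty does
  not determine them.\<close>

definition mode3 :: "real mat \<Rightarrow> nat \<Rightarrow> nat \<Rightarrow> ctensor \<Rightarrow> ctensor" where
  "mode3 M r c A = map (\<lambda>k. mat r c (\<lambda>(i, j).
     \<Sum>l<dim_col M. complex_of_real (M $$ (k, l)) * (A ! l $$ (i, j)))) [0..<dim_row M]"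

lemma mode3_carrier: "mode3 M r c A \<in> carrier_tensor r c (dim_row M)"
  by (auto simp: mode3_def carrier_tensor_def)

lemma mode3_one:
  assumes "A \<in> carrier_tensor r c n"
  shows "mode3 (1\<^sub>m n) r c A = A"
proof (rule nth_equalityI)
  fix k assume "k < length (mode3 (1\<^sub>m n) r c A)"
  then have k: "k < n" by (simp add: mode3_def)
  then have "(\<Sum>l<n. complex_of_real (1\<^sub>m n $$ (k, l)) * f l) = f k" for f
    by (subst sum.remove[of _ k]) auto
  then show "mode3 (1\<^sub>m n) r c A ! k = A ! k"
    using k assms by (intro eq_matI) (auto simp: mode3_def carrier_tensor_def)
qed (use assms in \<open>auto simp: mode3_def carrier_tensor_def\<close>)

lemma mode3_mode3:
  assumes "M \<in> carrier_mat p q" "N \<in> carrier_mat q s"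
  shows "mode3 M r c (mode3 N r c A) = mode3 (M * N) r c A"
proof (rule nth_equalityI)
  fix k assume "k < length (mode3 M r c (mode3 N r c A))"
  then have k: "k < p" using assms by (simp add: mode3_def)
  have "(\<Sum>l<q. complex_of_real (M $$ (k, l)) *
        (\<Sum>t<s. complex_of_real (N $$ (l, t)) * (A ! t $$ (i, j)))) =
      (\<Sum>t<s. complex_of_real ((M * N) $$ (k, t)) * (A ! t $$ (i, j)))" for i j
  proof -
    have "(\<Sum>t<s. complex_of_real ((M * N) $$ (k, t)) * (A ! t $$ (i, j))) =
      (\<Sum>t<s. \<Sum>l<q.
          complex_of_real (M $$ (k, l)) * (complex_of_real (N $$ (l, t)) * (A ! t $$ (i, j))))"
      using k assms
      by (intro sum.cong) (auto simp: scalar_prod_def sum_distrib_right atLeast0LessThan mult.assoc)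
    also have "\<dots> = (\<Sum>l<q. \<Sum>t<s.
          complex_of_real (M $$ (k, l)) * (complex_of_real (N $$ (l, t)) * (A ! t $$ (i, j))))"
      by (rule sum.swap)
    finally show ?thesis by (simp add: sum_distrib_left)
  qed
  then show "mode3 M r c (mode3 N r c A) ! k = mode3 (M * N) r c A ! k"
    using k assms by (intro eq_matI) (auto simp: mode3_def)
qed (use assms in \<open>auto simp: mode3_def\<close>)

text \<open>An entry of the product is a linear combination of the entries of \<open>A\<close> in the same row and
  column, so entries that vanish in all slices keep vanishing.\<close>

lemma F_upper_mode3:
  assumes "F_upper A" "A \<in> carrier_tensor n n (dim_col M)"
  shows "F_upper (mode3 M n n A)"
  using assms
  by (auto simp: F_upper_def mode3_def carrier_tensor_def upper_triangular_def intro!: sum.neutral)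

section \<open>Tensor operations through the transform\<close>

lemma tdim_carrier:
  assumes "A \<in> carrier_tensor n1 n2 n3" "0 < n3"
  shows "tdim_row A = n1" "tdim_col A = n2" "length A = n3"
  using assms by (auto simp: carrier_tensor_def tdim_row_def tdim_col_def)

lemma L_trans_conv_mode3:
  assumes "A \<in> carrier_tensor n1 n2 n3" "0 < n3"
  shows "L_trans A = mode3 (dct_M n3) n1 n2 A"
  using tdim_carrier[OF assms] carrier_matD[OF dct_M_carrier[of n3]]
  by (simp add: L_trans_def mode3_def)

lemma L_trans_carrier:
  assumes "A \<in> carrier_tensor n1 n2 n3" "0 < n3"
  shows "L_trans A \<in> carrier_tensor n1 n2 n3"
  using mode3_carrier[of "dct_M n3" n1 n2 A] carrier_matD[OF dct_M_carrier[of n3]]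
  by (simp add: L_trans_conv_mode3[OF assms])

lemma L_trans_inj:
  assumes "A \<in> carrier_tensor n1 n2 n3" "B \<in> carrier_tensor n1 n2 n3" "0 < n3"
    and eq: "\<And>i. i < n3 \<Longrightarrow> L_trans A ! i = L_trans B ! i"
  shows "A = B"
proof -
  note M = mat_inverse_of_det_nonzero[OF dct_M_carrier det_dct_M_nonzero]
  have "L_trans A = L_trans B"
    using eq L_trans_carrier[OF assms(1,3)] L_trans_carrier[OF assms(2,3)]
    by (intro nth_equalityI) (auto simp: carrier_tensor_def)
  then have "mode3 (the (mat_inverse (dct_M n3))) n1 n2 (mode3 (dct_M n3) n1 n2 A) =
      mode3 (the (mat_inverse (dct_M n3))) n1 n2 (mode3 (dct_M n3) n1 n2 B)"
    using assms by (simp add: L_trans_conv_mode3)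
  then show ?thesis
    unfolding mode3_mode3[OF M(1) dct_M_carrier] M(3) using assms by (simp add: mode3_one)
qed

text \<open>The preimage is obtained by applying the inverse of \<open>dct_M\<close>.  That explicit form also shows
  that square F-upper tensors have F-upper preimages, which the mere existence of a preimage would
  not give.\<close>

lemma L_trans_surj:
  assumes B: "B \<in> carrier_tensor n1 n2 n3" and n3: "0 < n3"
  obtains A where "A \<in> carrier_tensor n1 n2 n3" "L_trans A = B"
    "n1 = n2 \<Longrightarrow> F_upper B \<Longrightarrow> F_upper A"
proof
  note M = mat_inverse_of_det_nonzero[OF dct_M_carrier det_dct_M_nonzero]
  let ?A = "mode3 (the (mat_inverse (dct_M n3))) n1 n2 B"
  show A: "?A \<in> carrier_tensor n1 n2 n3"
    using mode3_carrier[of "the (mat_inverse (dct_M n3))" n1 n2 B] M(1)[of n3] by simp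
  show "L_trans ?A = B"
    unfolding L_trans_conv_mode3[OF A n3] mode3_mode3[OF dct_M_carrier M(1)] M(2)
    by (rule mode3_one[OF B])
  show "F_upper ?A" if "n1 = n2" "F_upper B"
    using that B M(1)[of n3] by (auto intro!: F_upper_mode3)
qed

text \<open>The product, the adjoint and the identity tensor are all definite descriptions of this form,
  and bijectivity of the transform makes them well defined.\<close>

lemma the_tensor_with_transform:
  assumes S: "\<And>i. i < n3 \<Longrightarrow> S i \<in> carrier_mat n1 n2" and n3: "0 < n3"
  defines "C \<equiv> THE C. C \<in> carrier_tensor n1 n2 n3 \<and> (\<forall>i<n3. L_trans C ! i = S i)"
  shows "C \<in> carrier_tensor n1 n2 n3 \<and> (\<forall>i<n3. L_trans C ! i = S i)"
  unfolding C_def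
proof (rule theI')
  have "map S [0..<n3] \<in> carrier_tensor n1 n2 n3" using S by (auto simp: carrier_tensor_def)
  from L_trans_surj[OF this n3] obtain A where
    "A \<in> carrier_tensor n1 n2 n3" "L_trans A = map S [0..<n3]" by auto
  then show "\<exists>!C. C \<in> carrier_tensor n1 n2 n3 \<and> (\<forall>i<n3. L_trans C ! i = S i)"
    using n3 by (intro ex1I[of _ A]) (auto intro: L_trans_inj)
qed

lemma L_trans_slice_carrier:
  assumes "A \<in> carrier_tensor n1 n2 n3" "i < n3"
  shows "L_trans A ! i \<in> carrier_mat n1 n2"
  using L_trans_carrier[OF assms(1)] assms(2) by (auto simp: carrier_tensor_def)

lemma c_prod_slicewise:
  assumes "A \<in> carrier_tensor n1 n2 n3" "B \<in> carrier_tensor n2 l n3" "0 < n3"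
  shows "A *\<^sub>c B \<in> carrier_tensor n1 l n3"
    and "\<And>i. i < n3 \<Longrightarrow> L_trans (A *\<^sub>c B) ! i = L_trans A ! i * L_trans B ! i"
proof -
  have "L_trans A ! i * L_trans B ! i \<in> carrier_mat n1 l" if "i < n3" for i
    using L_trans_slice_carrier[OF assms(1) that] L_trans_slice_carrier[OF assms(2) that]
    by (rule mult_carrier_mat)
  from the_tensor_with_transform[OF this assms(3)]
  show "A *\<^sub>c B \<in> carrier_tensor n1 l n3"
    and "\<And>i. i < n3 \<Longrightarrow> L_trans (A *\<^sub>c B) ! i = L_trans A ! i * L_trans B ! i"
    unfolding c_prod_def tdim_carrier[OF assms(1,3)] tdim_carrier[OF assms(2,3)] by simp_all
qed

lemma tensor_adjoint_slicewise:
  assumes "A \<in> carrier_tensor n1 n2 n3" "0 < n3"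
  shows "tensor_adjoint A \<in> carrier_tensor n2 n1 n3"
    and "\<And>i. i < n3 \<Longrightarrow> L_trans (tensor_adjoint A) ! i = mat_adjoint (L_trans A ! i)"
  using the_tensor_with_transform[of n3 "\<lambda>i. mat_adjoint (L_trans A ! i)" n2 n1]
    L_trans_slice_carrier[OF assms(1)] assms(2) tdim_carrier[OF assms]
  by (auto simp: tensor_adjoint_def)

lemma id_tensor_slicewise:
  assumes "0 < n3"
  shows "id_tensor n n3 \<in> carrier_tensor n n n3"
    and "\<And>i. i < n3 \<Longrightarrow> L_trans (id_tensor n n3) ! i = 1\<^sub>m n"
  using the_tensor_with_transform[of n3 "\<lambda>i. 1\<^sub>m n" n n] assms by (auto simp: id_tensor_def)

text \<open>Half of the definition is enough slicewise: a one-sided inverse of a square matrix is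
  two-sided.\<close>

lemma unitary_tensorI:
  assumes Q: "Q \<in> carrier_tensor n n n3" and n3: "0 < n3"
    and U: "\<And>i. i < n3 \<Longrightarrow> L_trans Q ! i * mat_adjoint (L_trans Q ! i) = 1\<^sub>m n"
  shows "unitary_tensor n n3 Q"
proof -
  note a = tensor_adjoint_slicewise[OF Q n3]
  have U': "mat_adjoint (L_trans Q ! i) * L_trans Q ! i = 1\<^sub>m n" if "i < n3" for i
    using mat_mult_left_right_inverse[OF _ _ U[OF that]] L_trans_slice_carrier[OF Q that] by auto
  have "tensor_adjoint Q *\<^sub>c Q = id_tensor n n3"
    using c_prod_slicewise[OF a(1) Q n3] id_tensor_slicewise[OF n3] a(2) U' n3
    by (intro L_trans_inj) auto
  moreover have "Q *\<^sub>c tensor_adjoint Q = id_tensor n n3"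
    using c_prod_slicewise[OF Q a(1) n3] id_tensor_slicewise[OF n3] a(2) U n3
    by (intro L_trans_inj) auto
  ultimately show ?thesis using Q by (simp add: unitary_tensor_def)
qed

theorem theorem3p6:
  fixes n n3 :: nat and A :: ctensor
  assumes "0 < n3" and "A \<in> carrier_tensor n n n3"
  shows "\<exists>Q T. unitary_tensor n n3 Q \<and> T \<in> carrier_tensor n n n3 \<and> F_upper T \<and>
           A = tensor_adjoint Q *\<^sub>c T *\<^sub>c Q"
proof -
  note n3 = assms(1) and A = assms(2)
  have "\<forall>i<n3. \<exists>U T. U \<in> carrier_mat n n \<and> T \<in> carrier_mat n n \<and> mat_adjoint U * U = 1\<^sub>m n \<and>
      upper_triangular T \<and> L_trans A ! i = U * T * mat_adjoint U"
    using unitary_schur_decomposition[OF L_trans_slice_carrier[OF A]] by blast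
  then obtain U S where US: "\<And>i. i < n3 \<Longrightarrow> U i \<in> carrier_mat n n \<and> S i \<in> carrier_mat n n \<and>
      mat_adjoint (U i) * U i = 1\<^sub>m n \<and> upper_triangular (S i) \<and>
      L_trans A ! i = U i * S i * mat_adjoint (U i)"
    by metis
  have "map (\<lambda>i. mat_adjoint (U i)) [0..<n3] \<in> carrier_tensor n n n3"
    using US by (auto simp: carrier_tensor_def)
  then obtain Q where Q: "Q \<in> carrier_tensor n n n3"
    and LQ: "L_trans Q = map (\<lambda>i. mat_adjoint (U i)) [0..<n3]"
    using L_trans_surj n3 by metis
  have S: "map S [0..<n3] \<in> carrier_tensor n n n3" "F_upper (map S [0..<n3])"
    using US by (auto simp: carrier_tensor_def F_upper_def)
  then obtain T where T: "T \<in> carrier_tensor n n n3" "F_upper T"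
    and LT: "L_trans T = map S [0..<n3]"
    using L_trans_surj n3 by metis
  note adj = tensor_adjoint_slicewise[OF Q n3]
  note QT = c_prod_slicewise[OF adj(1) T(1) n3]
  note QTQ = c_prod_slicewise[OF QT(1) Q n3]
  have "unitary_tensor n n3 Q"
    using US by (intro unitary_tensorI[OF Q n3]) (simp add: LQ)
  moreover have "A = tensor_adjoint Q *\<^sub>c T *\<^sub>c Q"
    using US by (intro L_trans_inj[OF A QTQ(1) n3]) (simp add: QTQ(2) QT(2) adj(2) LQ LT)
  ultimately show ?thesis using T by blast
qed

end
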